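(* The group $\operatorname{Aut}_+({}^{b}\mathbb{R}^2)$ is isomorphic to $\mathbb{R}\times\mathbb{R}$. More precisely, it is generated by the following two 1-parameter subgroups: the vertical translations $(x,y)\mapsto (x,y+t)$, $t\in\mathbb{R}$, and the horizontal scalings $(x,y)\mapsto (e^{t}x,y)$, $t\in\mathbb{R}$.
   Context: Let $L_1 = x\partial_x + i\,\partial_y$, a smooth complex vector field on $\mathbb{R}^2$ with coordinates $(x,y)$, and let $\langle L_1\rangle$ be the $C^\infty(\mathbb{R}^2,\mathbb{C})$-module of complex vector fields generated by $L_1$, i.e. $\{fL_1 : f\in C^\infty(\mathbb{R}^2,\mathbb{C})\}$. The standard $b$-complex plane is the pair ${}^{b}\mathbb{R}^2=(\mathbb{R}^2,\langle L_1\rangle)$. An automorphism of ${}^{b}\mathbb{R}^2$ is a ($C^\infty$) diffeomorphism $\theta:\mathbb{R}^2\to\mathbb{R}^2$ satisfying $\theta_*(\langle L_1\rangle)=\langle L_1\rangle$, where $\theta_*$ denotes the pushforward of vector fields, extended complex-linearly to complex vector fields. The automorphisms form a group $\operatorname{Aut}({}^{b}\mathbb{R}^2)$ under composition. Let $\mathbb{R}^2_+=\{(x,y)\in\mathbb{R}^2 : x>0\}$ be the open right half-plane; $\operatorname{Aut}_+({}^{b}\mathbb{R}^2)$ is the subgroup of those $\theta\in\operatorname{Aut}({}^{b}\mathbb{R}^2)$ that preserve it, i.e. $\theta(\mathbb{R}^2_+)=\mathbb{R}^2_+$. The group $\mathbb{R}\times\mathbb{R}$ is the additive group. *)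

theory Defs
  imports "HOL-Analysis.Analysis" "HOL-Algebra.Generated_Groups"
begin

text \<open>On a finite-dimensional domain, \<open>f\<close> is of class \<open>C\<^sup>k\<^sup>+\<^sup>1\<close> iff it is differentiable and all its
  directional derivatives \<open>x \<mapsto> D f(x) v\<close> are of class \<open>C\<^sup>k\<close>.\<close>

primrec C_k :: "nat \<Rightarrow> ('a::euclidean_space \<Rightarrow> 'b::real_normed_vector) \<Rightarrow> bool" where
  "C_k 0 f \<longleftrightarrow> continuous_on UNIV f"
| "C_k (Suc k) f \<longleftrightarrow>
     (\<forall>x. f differentiable (at x)) \<and> (\<forall>v. C_k k (\<lambda>x. frechet_derivative f (at x) v))"

definition smooth :: "('a::euclidean_space \<Rightarrow> 'b::real_normed_vector) \<Rightarrow> bool" where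
  "smooth f \<longleftrightarrow> (\<forall>k. C_k k f)"

definition diffeomorphism :: "('a::euclidean_space \<Rightarrow> 'a) \<Rightarrow> bool" where
  "diffeomorphism \<theta> \<longleftrightarrow> bij \<theta> \<and> smooth \<theta> \<and> smooth (inv_into UNIV \<theta>)"

text \<open>The complex vector field \<open>a \<partial>\<^sub>x + b \<partial>\<^sub>y\<close> on the plane is represented by the map \<open>p \<mapsto> (a p, b p)\<close>.\<close>

type_synonym plane = "real \<times> real"
type_synonym cvf = "plane \<Rightarrow> complex \<times> complex"

definition generated_module :: "cvf \<Rightarrow> cvf set" where
  "generated_module X =
     {(\<lambda>p. (f p * fst (X p), f p * snd (X p))) | f :: plane \<Rightarrow> complex. smooth f}"

text \<open>Complex-linear extension of a real-linear map: \<open>A\<^sup>\<complex> (u + \<i> w) = A u + \<i> (A w)\<close>.\<close>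

definition complexify :: "(plane \<Rightarrow> plane) \<Rightarrow> complex \<times> complex \<Rightarrow> complex \<times> complex" where
  "complexify A z =
     (let u = A (Re (fst z), Re (snd z)); w = A (Im (fst z), Im (snd z))
      in (Complex (fst u) (fst w), Complex (snd u) (snd w)))"

definition pushforward :: "(plane \<Rightarrow> plane) \<Rightarrow> cvf \<Rightarrow> cvf" where
  "pushforward \<theta> X =
     (\<lambda>q. complexify (frechet_derivative \<theta> (at (inv_into UNIV \<theta> q))) (X (inv_into UNIV \<theta> q)))"

definition L\<^sub>1 :: cvf where
  "L\<^sub>1 = (\<lambda>(x, y). (complex_of_real x, \<i>))"

definition Aut_b :: "(plane \<Rightarrow> plane) monoid" where
  "Aut_b =
     \<lparr>carrier = {\<theta>. diffeomorphism \<theta> \<and>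
                     pushforward \<theta> ` generated_module L\<^sub>1 = generated_module L\<^sub>1},
      monoid.mult = (\<circ>), one = id\<rparr>"

definition right_half_plane :: "plane set" where
  "right_half_plane = {(x, y). x > 0}"

definition Aut_b_plus :: "(plane \<Rightarrow> plane) monoid" where
  "Aut_b_plus =
     Aut_b\<lparr>carrier := {\<theta> \<in> carrier Aut_b. \<theta> ` right_half_plane = right_half_plane}\<rparr>"

definition real_add_group :: "real monoid" where
  "real_add_group = \<lparr>carrier = UNIV, monoid.mult = (+), one = 0\<rparr>"

definition vertical_translation :: "real \<Rightarrow> plane \<Rightarrow> plane" where
  "vertical_translation t = (\<lambda>(x, y). (x, y + t))"

definition horizontal_scaling :: "real \<Rightarrow> plane \<Rightarrow> plane" where
  "horizontal_scaling t = (\<lambda>(x, y). (exp t * x, y))"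

end

theory Submission
  imports Defs "HOL-Complex_Analysis.Conformal_Mappings"
    "HOL-Computational_Algebra.Fundamental_Theorem_Algebra" "HOL-Real_Asymp.Real_Asymp"
begin

text \<open>Write \<open>\<theta> = (u, v)\<close>. That \<open>\<theta>\<^sub>* L\<^sub>1\<close> is a multiple of \<open>L\<^sub>1\<close> means
  \<open>x u\<^sub>x = u v\<^sub>y\<close> and \<open>u\<^sub>y = - x u v\<^sub>x\<close>. On the right half-plane, in the coordinates
  \<open>s = ln x\<close>, \<open>U = ln u\<close>, these are the Cauchy-Riemann equations for
  \<open>s + \<i> y \<mapsto> U + \<i> v\<close>, which is thus a holomorphic bijection of the complex plane, hence
  \<open>z \<mapsto> a z + b\<close>. Continuity of \<open>v\<close> at the axis \<open>x = 0\<close> makes \<open>a\<close> real, so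
  \<open>u = c x\<^sup>a\<close>, and since \<open>D\<theta>\<close> is finite and invertible on the axis, \<open>a = 1\<close>. Conjugating with
  the reflection in the axis gives the same form on the left half-plane, and differentiability
  across the axis forces the two sides to agree.\<close>

section \<open>Bijective entire functions\<close>

text \<open>The inverse of an injective holomorphic map is holomorphic, hence continuous, so
  preimages of compact sets are compact and \<open>F\<close> is a polynomial. Injectivity keeps
  \<open>deriv F\<close> free of zeros, and a polynomial without complex zeros is constant.\<close>

lemma bij_entire_affine:
  assumes hol: "F holomorphic_on UNIV" and bij: "bij F"
  obtains a b where "a \<noteq> 0" and "\<And>z. F z = a * z + b"
proof -
  have inj: "inj F" and surj: "range F = UNIV"
    using bij by (auto simp: bij_def)
  obtain G where G: "G holomorphic_on (F ` UNIV)" "\<And>z. z \<in> UNIV \<Longrightarrow> G (F z) = z"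
    using holomorphic_has_inverse[OF hol open_UNIV inj] by metis
  have contG: "continuous_on UNIV G"
    using holomorphic_on_imp_continuous_on[OF G(1)] surj by simp
  have FG: "F (G w) = w" for w
    using G(2) surj by (metis UNIV_I rangeE)
  \<comment> \<open>A proper entire function is a polynomial.\<close>
  have "compact {z. F z \<in> K}" if "compact K" for K
  proof -
    have "{z. F z \<in> K} = G ` K"
      using G(2) FG by (auto simp: image_iff) metis
    then show ?thesis
      using compact_continuous_image[OF continuous_on_subset[OF contG] that] by simp
  qed
  then obtain c n where F: "F = (\<lambda>z. \<Sum>i\<le>n. c i * z ^ i)"
    using proper_map_polyfun_eq[OF hol] by blast
  define p where "p = (\<Sum>i\<le>n. monom (c i) i)"
  have Fp: "F = poly p"
    by (simp add: F p_def poly_sum poly_monom fun_eq_iff)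
  have dF: "deriv F z = poly (pderiv p) z" for z
    unfolding Fp by (rule DERIV_imp_deriv[OF poly_DERIV])
  have nz: "deriv F z \<noteq> 0" for z
    using holomorphic_injective_imp_regular[OF hol open_UNIV inj] by simp
  then have "constant (poly (pderiv p))"
    using Fundamental_Theorem_Algebra.fundamental_theorem_of_algebra[of "pderiv p"] dF by metis
  then have a: "poly (pderiv p) z = poly (pderiv p) 0" for z
    by (simp only: Fundamental_Theorem_Algebra.constant_def)
  define a where "a = poly (pderiv p) 0"
  have "((\<lambda>z. F z - a * z) has_field_derivative 0) (at z)" for z
    using DERIV_diff[OF poly_DERIV[of p z] DERIV_cmult_Id[of a]] a[of z] by (simp add: Fp a_def)
  then obtain b where b: "\<And>z. F z - a * z = b"
    using has_field_derivative_zero_constant[OF convex_UNIV, of "\<lambda>z. F z - a * z"] by (metis UNIV_I)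
  show thesis
  proof
    show "a \<noteq> 0" using nz[of 0] by (simp add: dF a_def)
    show "F z = a * z + b" for z using b[of z] by (simp add: algebra_simps)
  qed
qed

section \<open>The open half-plane in logarithmic coordinates\<close>

lemma mem_right_half_plane [simp]: "p \<in> right_half_plane \<longleftrightarrow> fst p > 0"
  by (simp add: right_half_plane_def case_prod_unfold)

text \<open>With \<open>\<theta>\<close> = (u, v), s = ln x and U = ln u, dividing both equations by
  u > 0 turns them into U_s = v_y and U_y = - v_s. These are the Cauchy-Riemann equations for the
  conjugate \<open>F\<close> of \<open>\<theta>\<close> by the logarithm, a bijection of the complex
  plane.\<close>

lemma half_plane_log_affine:
  assumes bij: "bij_betw \<theta> right_half_plane right_half_plane"
    and der: "\<And>p. p \<in> right_half_plane \<Longrightarrow> (\<theta> has_derivative D p) (at p)"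
    and CR1: "\<And>p. p \<in> right_half_plane \<Longrightarrow>
      fst p * fst (D p (1, 0)) = fst (\<theta> p) * snd (D p (0, 1))"
    and CR2: "\<And>p. p \<in> right_half_plane \<Longrightarrow>
      fst (D p (0, 1)) = - (fst p * fst (\<theta> p) * snd (D p (1, 0)))"
  obtains a b where "a \<noteq> 0"
    and "\<And>s y. ln (fst (\<theta> (exp s, y))) = Re (a * Complex s y + b)"
    and "\<And>s y. snd (\<theta> (exp s, y)) = Im (a * Complex s y + b)"
proof -
  define E where "E z = (exp (Re z), Im z)" for z
  define Lg where "Lg p = Complex (ln (fst p)) (snd p)" for p :: plane
  have bE: "bij_betw E UNIV right_half_plane"
    by (rule bij_betw_byWitness[where f' = Lg])
       (auto simp: E_def Lg_def right_half_plane_def)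
  have bL: "bij_betw Lg right_half_plane UNIV"
    by (rule bij_betw_byWitness[where f' = E])
       (auto simp: E_def Lg_def right_half_plane_def)
  define F where "F = Lg \<circ> (\<theta> \<circ> E)"
  have bF: "bij F"
    unfolding F_def by (rule bij_betw_trans[OF bij_betw_trans[OF bE bij] bL])
  have "F field_differentiable (at z)" for z
  proof -
    let ?p = "E z"
    have p: "?p \<in> right_half_plane" by (simp add: E_def right_half_plane_def)
    have q: "fst (\<theta> ?p) > 0"
      using bspec[OF bij_betwE[OF bij] p] by simp
    have "(E has_derivative (\<lambda>h. (exp (Re z) * Re h, Im h))) (at z)"
      unfolding E_def[abs_def] by (auto intro!: derivative_eq_intros)
    from diff_chain_at[OF this der[OF p]]
    have d: "((\<lambda>w. \<theta> (E w)) has_derivative (\<lambda>h. D ?p (exp (Re z) * Re h, Im h))) (at z)"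
      by (simp add: o_def)
    have lin: "D ?p (h, k) = h *\<^sub>R D ?p (1, 0) + k *\<^sub>R D ?p (0, 1)" for h k
    proof -
      have "linear (D ?p)" using der[OF p] by (rule has_derivative_linear)
      then have "D ?p (h *\<^sub>R (1, 0) + k *\<^sub>R (0, 1)) = h *\<^sub>R D ?p (1, 0) + k *\<^sub>R D ?p (0, 1)"
        by (simp only: linear_add linear_scale)
      then show ?thesis by simp
    qed
    have F': "F = (\<lambda>w. complex_of_real (ln (fst (\<theta> (E w)))) + \<i> * complex_of_real (snd (\<theta> (E w))))"
      by (auto simp: F_def Lg_def Complex_eq)
    have "(F has_derivative (\<lambda>h. complex_of_real (fst (D ?p (exp (Re z) * Re h, Im h)) / fst (\<theta> ?p))
            + \<i> * complex_of_real (snd (D ?p (exp (Re z) * Re h, Im h))))) (at z)"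
      unfolding F' using q
      by (auto intro!: derivative_eq_intros d simp: field_simps)
    \<comment> \<open>The real derivative is multiplication by the complex number U_s + i v_s; here
      U_s is written as v_y, and v_s = x v_x with x = \<open>exp (Re z)\<close>.\<close>
    moreover have "(\<lambda>h. complex_of_real (fst (D ?p (exp (Re z) * Re h, Im h)) / fst (\<theta> ?p))
            + \<i> * complex_of_real (snd (D ?p (exp (Re z) * Re h, Im h))))
        = (*) (Complex (snd (D ?p (0, 1))) (exp (Re z) * snd (D ?p (1, 0))))"
    proof
      fix h
      have 1: "exp (Re z) * fst (D ?p (1, 0)) = fst (\<theta> ?p) * snd (D ?p (0, 1))"
        using CR1[OF p] by (simp add: E_def)
      have 2: "fst (D ?p (0, 1)) = - (exp (Re z) * fst (\<theta> ?p) * snd (D ?p (1, 0)))"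
        using CR2[OF p] by (simp add: E_def)
      have "fst (D ?p (exp (Re z) * Re h, Im h))
          = Re h * (exp (Re z) * fst (D ?p (1, 0))) + Im h * fst (D ?p (0, 1))"
        by (subst lin) simp
      also have "\<dots> = fst (\<theta> ?p) * (Re h * snd (D ?p (0, 1)) - Im h * (exp (Re z) * snd (D ?p (1, 0))))"
        unfolding 1 2 by (simp add: algebra_simps)
      finally have 3: "fst (D ?p (exp (Re z) * Re h, Im h)) / fst (\<theta> ?p)
          = Re h * snd (D ?p (0, 1)) - Im h * (exp (Re z) * snd (D ?p (1, 0)))"
        using q by simp
      have 4: "snd (D ?p (exp (Re z) * Re h, Im h))
          = Re h * (exp (Re z) * snd (D ?p (1, 0))) + Im h * snd (D ?p (0, 1))"
        by (subst lin) simp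
      show "complex_of_real (fst (D ?p (exp (Re z) * Re h, Im h)) / fst (\<theta> ?p))
            + \<i> * complex_of_real (snd (D ?p (exp (Re z) * Re h, Im h)))
          = Complex (snd (D ?p (0, 1))) (exp (Re z) * snd (D ?p (1, 0))) * h"
        unfolding 3 4 by (simp add: complex_eq_iff algebra_simps)
    qed
    ultimately show ?thesis
      by (metis field_differentiable_def has_field_derivative_def)
  qed
  then have "F holomorphic_on UNIV"
    by (simp add: holomorphic_on_def field_differentiable_at_within)
  from bij_entire_affine[OF this bF] obtain a b where ab: "a \<noteq> 0" "\<And>z. F z = a * z + b"
    by metis
  show thesis
  proof
    show "a \<noteq> 0" by fact
    show "ln (fst (\<theta> (exp s, y))) = Re (a * Complex s y + b)" for s y
      using ab(2)[of "Complex s y"] by (simp add: F_def Lg_def E_def complex_eq_iff)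
    show "snd (\<theta> (exp s, y)) = Im (a * Complex s y + b)" for s y
      using ab(2)[of "Complex s y"] by (simp add: F_def Lg_def E_def complex_eq_iff)
  qed
qed

section \<open>Behaviour at the axis\<close>

text \<open>Reduces the x-derivative at the origin to one-variable difference quotients, whose
  limits can then be taken from one side only.\<close>

lemma has_derivative_slice:
  fixes \<theta> :: "plane \<Rightarrow> plane"
  assumes der: "(\<theta> has_derivative D) (at (0, 0))"
  shows "((\<lambda>x. fst (\<theta> (x, 0))) has_real_derivative fst (D (1, 0))) (at 0)"
    and "((\<lambda>x. snd (\<theta> (x, 0))) has_real_derivative snd (D (1, 0))) (at 0)"
proof -
  have "((\<lambda>x. (x, 0)) has_derivative (\<lambda>h. (h, 0))) (at (0::real))"
    by (auto intro!: derivative_eq_intros)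
  from diff_chain_at[OF this der]
  have d: "((\<lambda>x. \<theta> (x, 0)) has_derivative (\<lambda>h. D (h, 0))) (at 0)" by (simp add: o_def)
  have D: "D (h, 0) = h *\<^sub>R D (1, 0)" for h
    using linear_scale[OF has_derivative_linear[OF der], of h "(1, 0)"] by simp
  have "(\<lambda>h. fst (D (h, 0))) = (*) (fst (D (1, 0)))"
    "(\<lambda>h. snd (D (h, 0))) = (*) (snd (D (1, 0)))"
    by (subst D, simp add: fun_eq_iff)+
  then show "((\<lambda>x. fst (\<theta> (x, 0))) has_real_derivative fst (D (1, 0))) (at 0)"
    "((\<lambda>x. snd (\<theta> (x, 0))) has_real_derivative snd (D (1, 0))) (at 0)"
    using has_derivative_fst[OF d] has_derivative_snd[OF d]
    by (simp_all add: has_field_derivative_def)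
qed

text \<open>For x > 0 the affine form gives u = exp (\<open>Re b\<close> - \<open>Im a\<close> y)
  x^(\<open>Re a\<close>) and v = \<open>Re a\<close> y + \<open>Im a\<close> ln x +
  \<open>Im b\<close>. Regularity at x = 0 then forces \<open>a\<close> = 1: continuity excludes
  \<open>Im a\<close> \<noteq> 0 and \<open>Re a\<close> < 0, a finite x-derivative at the origin
  excludes \<open>Re a\<close> < 1, and a nonzero one excludes \<open>Re a\<close> > 1.\<close>

lemma half_plane_scaling_translation:
  assumes bij: "bij_betw \<theta> right_half_plane right_half_plane"
    and der: "\<And>p. (\<theta> has_derivative D p) (at p)"
    and CR1: "\<And>p. p \<in> right_half_plane \<Longrightarrow>
      fst p * fst (D p (1, 0)) = fst (\<theta> p) * snd (D p (0, 1))"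
    and CR2: "\<And>p. p \<in> right_half_plane \<Longrightarrow>
      fst (D p (0, 1)) = - (fst p * fst (\<theta> p) * snd (D p (1, 0)))"
    and nz: "D (0, 0) (1, 0) \<noteq> 0"
  obtains c d where "c > 0" and "\<And>x y. x \<ge> 0 \<Longrightarrow> \<theta> (x, y) = (c * x, y + d)"
proof -
  obtain a b where a0: "a \<noteq> 0"
    and u: "\<And>s y. ln (fst (\<theta> (exp s, y))) = Re (a * Complex s y + b)"
    and v: "\<And>s y. snd (\<theta> (exp s, y)) = Im (a * Complex s y + b)"
    using half_plane_log_affine[OF bij der CR1 CR2] by metis
  have pos: "fst (\<theta> (x, y)) > 0" if "x > 0" for x y
    using bspec[OF bij_betwE[OF bij], of "(x, y)"] that by simp
  have U: "fst (\<theta> (x, y)) = exp (Re a * ln x - Im a * y + Re b)" if "x > 0" for x y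
  proof -
    have "ln (fst (\<theta> (x, y))) = Re a * ln x - Im a * y + Re b"
      using u[of "ln x" y] that by simp
    then show ?thesis using exp_ln[OF pos[OF that, of y]] by simp
  qed
  have V: "snd (\<theta> (x, y)) = Re a * y + Im a * ln x + Im b" if "x > 0" for x y
    using v[of "ln x" y] that by simp
  have ev: "eventually P (at_right 0)" if "\<And>x. x > 0 \<Longrightarrow> P x" for P :: "real \<Rightarrow> bool"
    using eventually_at_right_less[of 0] by (rule eventually_mono) (rule that)
  have cont: "((\<lambda>x. \<theta> (x, y)) \<longlongrightarrow> \<theta> (0, y)) (at_right 0)" for y
  proof -
    have "isCont \<theta> (0, y)" using der has_derivative_continuous by blast
    moreover have "((\<lambda>x. (x, y)) \<longlongrightarrow> (0, y)) (at_right 0)"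
      by (intro tendsto_intros)
    ultimately show ?thesis by (rule isCont_tendsto_compose)
  qed
  \<comment> \<open>Otherwise ln x could be solved for in terms of v(x, 0), which has a finite limit
    as x tends to 0 from the right.\<close>
  have Im0: "Im a = 0"
  proof (rule ccontr)
    assume "Im a \<noteq> 0"
    have "((\<lambda>x. (snd (\<theta> (x, 0)) - Im b) / Im a) \<longlongrightarrow> (snd (\<theta> (0, 0)) - Im b) / Im a) (at_right 0)"
      using \<open>Im a \<noteq> 0\<close> by (intro tendsto_intros cont)
    then have "(ln \<longlongrightarrow> (snd (\<theta> (0, 0)) - Im b) / Im a) (at_right 0)"
      by (rule Lim_transform_eventually[OF _ ev]) (simp add: V \<open>Im a \<noteq> 0\<close>)
    from not_tendsto_and_filterlim_at_infinity[OF _ this filterlim_at_bot_imp_at_infinity[OF ln_at_0]]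
    show False by simp
  qed
  have Re_nz: "Re a \<noteq> 0" using a0 Im0 by (simp add: complex_eq_iff)
  have expo: "((\<lambda>x. exp (k * ln x + r)) \<longlongrightarrow> 0) (at_right (0::real))" if "k > 0" for k r :: real
  proof -
    have "filterlim (\<lambda>x. k * ln x + r) at_bot (at_right 0)"
      using that by real_asymp
    then show ?thesis by (rule filterlim_compose[OF exp_at_bot])
  qed
  have expo': "\<not> ((\<lambda>x. exp (k * ln x + r)) \<longlongrightarrow> l) (at_right (0::real))" if "k < 0" for k r l :: real
  proof -
    have "filterlim (\<lambda>x. k * ln x + r) at_top (at_right 0)"
      using that by real_asymp
    from filterlim_at_top_imp_at_infinity[OF filterlim_compose[OF exp_at_top this]]
    show ?thesis
      using not_tendsto_and_filterlim_at_infinity[OF trivial_limit_at_right_real] by auto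
  qed
  have "((\<lambda>x. exp (Re a * ln x + Re b)) \<longlongrightarrow> fst (\<theta> (0, 0))) (at_right 0)"
    by (rule Lim_transform_eventually[OF tendsto_fst[OF cont] ev]) (simp add: U)
  \<comment> \<open>A negative exponent would make u(x, 0) unbounded near the origin.\<close>
  then have Re_pos: "Re a > 0" using expo'[of "Re a" "Re b"] Re_nz by fastforce
  have axis: "\<theta> (0, y) = (0, Re a * y + Im b)" for y
  proof -
    have "((\<lambda>x. (exp (Re a * ln x + Re b), Re a * y + Im b)) \<longlongrightarrow> (0, Re a * y + Im b)) (at_right 0)"
      by (intro tendsto_Pair expo Re_pos tendsto_const)
    then have "((\<lambda>x. \<theta> (x, y)) \<longlongrightarrow> (0, Re a * y + Im b)) (at_right 0)"
      by (rule Lim_transform_eventually[OF _ ev]) (simp add: prod_eq_iff U V Im0)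
    from tendsto_unique[OF trivial_limit_at_right_real cont this] show ?thesis .
  qed
  \<comment> \<open>Since u vanishes at the origin, the difference quotient of u there is exp
    (\<open>Re b\<close>) x^(\<open>Re a\<close> - 1).\<close>
  have lim1: "((\<lambda>x. exp ((Re a - 1) * ln x + Re b)) \<longlongrightarrow> fst (D (0, 0) (1, 0))) (at_right 0)"
  proof -
    have "exp ((Re a - 1) * ln x + Re b) = (fst (\<theta> (x, 0)) - fst (\<theta> (0, 0))) / (x - 0)"
      if "x > 0" for x
    proof -
      have "(Re a - 1) * ln x + Re b = (Re a * ln x + Re b) - ln x"
        by (simp add: algebra_simps)
      then have "exp ((Re a - 1) * ln x + Re b) = exp (Re a * ln x + Re b) / exp (ln x)"
        by (simp only: exp_diff)
      then show ?thesis using that by (simp add: U axis)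
    qed
    note eq = this
    show ?thesis
      using has_field_derivative_at_within[OF has_derivative_slice(1)[OF der]]
      unfolding has_field_derivative_iff
      by (rule Lim_transform_eventually[OF _ ev]) (simp only: eq)
  qed
  \<comment> \<open>Along y = 0 the component v has the constant value \<open>Im b\<close>, so the
    nonzero vector \<open>D (0, 0) (1, 0)\<close> must have a nonzero first component.\<close>
  have "((\<lambda>x. 0) \<longlongrightarrow> snd (D (0, 0) (1, 0))) (at_right (0::real))"
    using has_field_derivative_at_within[OF has_derivative_slice(2)[OF der]]
    unfolding has_field_derivative_iff
    by (rule Lim_transform_eventually[OF _ ev]) (simp add: V axis Im0)
  then have "snd (D (0, 0) (1, 0)) = 0"
    by (simp add: tendsto_const_iff)
  then have nz1: "fst (D (0, 0) (1, 0)) \<noteq> 0"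
    using nz by (simp add: prod_eq_iff)
  have "\<not> Re a < 1" using lim1 expo'[of "Re a - 1" "Re b"] by auto
  moreover have "\<not> Re a > 1"
  proof
    assume "Re a > 1"
    then have "((\<lambda>x. exp ((Re a - 1) * ln x + Re b)) \<longlongrightarrow> 0) (at_right 0)"
      by (intro expo) simp
    from tendsto_unique[OF trivial_limit_at_right_real lim1 this] show False
      using nz1 by simp
  qed
  ultimately have Re1: "Re a = 1" by simp
  show thesis
  proof
    show "exp (Re b) > 0" by simp
    show "\<theta> (x, y) = (exp (Re b) * x, y + Im b)" if "x \<ge> 0" for x y
      using that axis[of y] by (cases "x = 0") (auto simp: prod_eq_iff U V Im0 Re1 exp_add)
  qed
qed


section \<open>Smoothness of affine maps\<close>

lemma C_k_const: "C_k k (\<lambda>_. c)"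
  by (induction k arbitrary: c) (auto simp: frechet_derivative_const)

lemma smooth_const: "smooth (\<lambda>_. c)"
  by (simp add: smooth_def C_k_const)

lemma has_derivative_affine:
  assumes "bounded_linear L"
  shows "((\<lambda>x. L x + c) has_derivative L) (at x)"
  using assms by (auto intro!: derivative_eq_intros bounded_linear_imp_has_derivative)

text \<open>The derivative of the composite along \<open>v\<close> is the derivative of
  \<open>f\<close> along the fixed vector \<open>L v\<close>, composed with the same affine map. The
  induction therefore runs over all \<open>f\<close>, with no product rule needed.\<close>

lemma C_k_compose_affine:
  assumes L: "bounded_linear L"
  shows "C_k k f \<Longrightarrow> C_k k (\<lambda>x. f (L x + c))"
proof (induction k arbitrary: f)
  case 0
  have "continuous_on UNIV (\<lambda>x. L x + c)"
    using has_derivative_affine[OF L] has_derivative_continuous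
    by (blast intro: continuous_at_imp_continuous_on)
  then show ?case
    using 0 continuous_on_compose2[of UNIV f UNIV "\<lambda>x. L x + c"] by simp
next
  case (Suc k)
  have d: "((\<lambda>x. f (L x + c)) has_derivative
      (\<lambda>v. frechet_derivative f (at (L x + c)) (L v))) (at x)" for x
    using diff_chain_at[OF has_derivative_affine[OF L, of c x], of f] Suc.prems
    by (simp add: o_def frechet_derivative_works)
  have "frechet_derivative (\<lambda>x. f (L x + c)) (at x)
      = (\<lambda>v. frechet_derivative f (at (L x + c)) (L v))" for x
    using frechet_derivative_at[OF d[of x]] by simp
  moreover have "C_k k (\<lambda>x. frechet_derivative f (at (L x + c)) (L v))" for v
    using Suc.prems by (intro Suc.IH) simp
  moreover have "(\<lambda>x. f (L x + c)) differentiable (at x)" for x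
    using d differentiable_def by blast
  ultimately show ?case by simp
qed

lemma C_k_id: "C_k k (\<lambda>x. x)"
  by (cases k) (auto simp: C_k_const frechet_derivative_ident)

lemma smooth_compose_affine:
  "bounded_linear L \<Longrightarrow> smooth f \<Longrightarrow> smooth (\<lambda>x. f (L x + c))"
  by (simp add: smooth_def C_k_compose_affine)

lemma smooth_affine:
  fixes L :: "'a::euclidean_space \<Rightarrow> 'b::euclidean_space"
  shows "bounded_linear L \<Longrightarrow> smooth (\<lambda>x. L x + c)"
  unfolding smooth_def by (intro allI C_k_compose_affine[where f = "\<lambda>x. x"] C_k_id)

section \<open>The two-parameter group of scalings and translations\<close>

text \<open>The parameters form one pair, so that this function is itself the isomorphism from the
  additive group of pairs; the scaling factor enters through its logarithm, so that composition adds
  parameters.\<close>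

definition scale_translate :: "real \<times> real \<Rightarrow> plane \<Rightarrow> plane" where
  "scale_translate = (\<lambda>(s, t) (x, y). (exp s * x, y + t))"

lemma scale_translate_add:
  "scale_translate (s, t) \<circ> scale_translate (s', t') = scale_translate (s + s', t + t')"
  by (auto simp: scale_translate_def exp_add fun_eq_iff)

lemma scale_translate_0: "scale_translate (0, 0) = id"
  by (auto simp: scale_translate_def)

lemma inj_scale_translate: "inj scale_translate"
proof (rule injI)
  fix p q assume "scale_translate p = scale_translate q"
  \<comment> \<open>The image of (1, 0) is (exp s, t), which determines both parameters.\<close>
  then have "scale_translate p (1, 0) = scale_translate q (1, 0)" by simp
  then show "p = q" by (auto simp: scale_translate_def prod_eq_iff case_prod_unfold)
qed

text \<open>Separates the linear part, which is the derivative at every point, so that the results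
  on affine maps apply.\<close>

lemma scale_translate_affine:
  obtains L where "bounded_linear L"
    and "scale_translate (s, t) = (\<lambda>p. L p + (0, t))" and "\<And>x y. L (x, y) = (exp s * x, y)"
proof
  show "bounded_linear (\<lambda>p :: plane. (exp s * fst p, snd p))"
    by (intro bounded_linear_Pair bounded_linear_const_mult bounded_linear_fst bounded_linear_snd)
qed (auto simp: scale_translate_def)

lemma bij_scale_translate: "bij (scale_translate (s, t))"
  and inv_scale_translate: "inv_into UNIV (scale_translate (s, t)) = scale_translate (- s, - t)"
proof -
  have "scale_translate (s, t) \<circ> scale_translate (- s, - t) = id"
    "scale_translate (- s, - t) \<circ> scale_translate (s, t) = id"
    by (simp_all add: scale_translate_add scale_translate_0)
  then show "bij (scale_translate (s, t))" "inv_into UNIV (scale_translate (s, t)) = scale_translate (- s, - t)"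
    using o_bij inv_unique_comp by metis+
qed

lemma smooth_scale_translate: "smooth (scale_translate (s, t))"
  by (rule scale_translate_affine[of s t]) (simp add: smooth_affine)

text \<open>The field \<open>L\<^sub>1\<close> is invariant: the linear part sends its value (x, i)
  to (exp s * x, i), its value at the image point. Only the coefficient moves, by composition with
  the inverse map.\<close>

lemma pushforward_scale_translate:
  "pushforward (scale_translate (s, t)) (\<lambda>p. (f p * fst (L\<^sub>1 p), f p * snd (L\<^sub>1 p)))
    = (\<lambda>q. (f (scale_translate (- s, - t) q) * fst (L\<^sub>1 q),
            f (scale_translate (- s, - t) q) * snd (L\<^sub>1 q)))"
proof -
  obtain L where L: "bounded_linear L"
    "scale_translate (s, t) = (\<lambda>p. L p + (0, t))" "\<And>x y. L (x, y) = (exp s * x, y)"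
    by (rule scale_translate_affine[of s t]) blast
  have "frechet_derivative (scale_translate (s, t)) (at p) = L" for p
    unfolding L(2) using frechet_derivative_at[OF has_derivative_affine[OF L(1)]] by simp
  then show ?thesis
    unfolding pushforward_def inv_scale_translate
    by (auto simp: fun_eq_iff complexify_def L(3) L\<^sub>1_def scale_translate_def complex_eq_iff
        exp_minus field_simps)
qed

lemma scale_translate_mem: "scale_translate (s, t) \<in> carrier Aut_b_plus"
proof -
  \<comment> \<open>Proved for all parameters, so that it also covers the inverse map; pushing
    forward by the inverse supplies the preimages for the opposite inclusion.\<close>
  have sub: "pushforward (scale_translate (s, t)) ` generated_module L\<^sub>1 \<subseteq> generated_module L\<^sub>1" for s t
  proof -
    have "smooth (\<lambda>q. f (scale_translate (- s, - t) q))" if "smooth f" for f :: "plane \<Rightarrow> complex"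
      by (rule scale_translate_affine[of "- s" "- t"]) (simp add: smooth_compose_affine that)
    then show ?thesis
      by (auto simp: generated_module_def pushforward_scale_translate)
  qed
  have "X \<in> pushforward (scale_translate (s, t)) ` generated_module L\<^sub>1"
    if X: "X \<in> generated_module L\<^sub>1" for X
  proof
    show "pushforward (scale_translate (- s, - t)) X \<in> generated_module L\<^sub>1"
      using sub X by blast
    obtain f where f: "X = (\<lambda>p. (f p * fst (L\<^sub>1 p), f p * snd (L\<^sub>1 p)))"
      using X by (auto simp: generated_module_def)
    have "scale_translate (s, t) (scale_translate (- s, - t) q) = q" for q
      using fun_cong[OF scale_translate_add[of s t "- s" "- t"], of q]
      by (simp add: scale_translate_0)
    then show "X = pushforward (scale_translate (s, t)) (pushforward (scale_translate (- s, - t)) X)"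
      unfolding f pushforward_scale_translate by simp
  qed
  then have "pushforward (scale_translate (s, t)) ` generated_module L\<^sub>1 = generated_module L\<^sub>1"
    using sub by blast
  moreover have "scale_translate (s, t) ` right_half_plane = right_half_plane"
  proof -
    have sub: "scale_translate (s, t) ` right_half_plane \<subseteq> right_half_plane" for s t
      by (auto simp: scale_translate_def)
    have "p = scale_translate (s, t) (scale_translate (- s, - t) p)" for p
      using fun_cong[OF scale_translate_add[of s t "- s" "- t"], of p]
      by (simp add: scale_translate_0)
    then show ?thesis using sub[of s t] sub[of "- s" "- t"] by blast
  qed
  ultimately show ?thesis
    by (simp add: Aut_b_plus_def Aut_b_def diffeomorphism_def bij_scale_translate
        smooth_scale_translate inv_scale_translate)
qed

section \<open>Determination of the automorphisms\<close>

text \<open>The pushforward of \<open>L\<^sub>1\<close> equals g \<open>L\<^sub>1\<close> for some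
  g. At \<open>\<theta> p\<close>, with \<open>\<theta>\<close> = (u, v), this reads x u_x + i u_y =
  g u and x v_x + i v_y = i g. The second equation gives g = v_y - i x v_x, and substitution into
  the first yields both claims.\<close>

lemma Aut_b_Cauchy_Riemann:
  assumes "\<theta> \<in> carrier Aut_b"
  defines "D \<equiv> \<lambda>p. frechet_derivative \<theta> (at p)"
  shows "fst p * fst (D p (1, 0)) = fst (\<theta> p) * snd (D p (0, 1))"
    and "fst (D p (0, 1)) = - (fst p * fst (\<theta> p) * snd (D p (1, 0)))"
proof -
  have bij: "bij \<theta>" and sm: "smooth \<theta>"
    and push: "pushforward \<theta> ` generated_module L\<^sub>1 = generated_module L\<^sub>1"
    using assms by (auto simp: Aut_b_def diffeomorphism_def)
  have "L\<^sub>1 \<in> generated_module L\<^sub>1"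
    unfolding generated_module_def using smooth_const[of "1::complex"] by force
  then have "pushforward \<theta> L\<^sub>1 \<in> generated_module L\<^sub>1" using push by blast
  then obtain g where g: "pushforward \<theta> L\<^sub>1 = (\<lambda>p. (g p * fst (L\<^sub>1 p), g p * snd (L\<^sub>1 p)))"
    by (auto simp: generated_module_def)
  have D: "frechet_derivative \<theta> (at p) = D p" by (simp add: D_def)
  have "\<theta> differentiable (at p)"
    using sm unfolding smooth_def by (metis C_k.simps(2))
  then have "linear (D p)"
    unfolding D_def by (rule linear_frechet_derivative)
  from linear_scale[OF this, of "fst p" "(1, 0)"]
  have lin: "D p (fst p, 0) = fst p *\<^sub>R D p (1, 0)" by simp
  have inv: "inv_into UNIV \<theta> (\<theta> p) = p" using bij by (simp add: bij_is_inj)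
  from fun_cong[OF g, of "\<theta> p"]
  have "fst p * fst (D p (1, 0)) = Re (g (\<theta> p)) * fst (\<theta> p)"
    "fst (D p (0, 1)) = Im (g (\<theta> p)) * fst (\<theta> p)"
    "Im (g (\<theta> p)) = - (fst p * snd (D p (1, 0)))"
    "Re (g (\<theta> p)) = snd (D p (0, 1))"
    by (auto simp: pushforward_def inv L\<^sub>1_def case_prod_unfold complexify_def Let_def
        D lin complex_eq_iff)
  then show "fst p * fst (D p (1, 0)) = fst (\<theta> p) * snd (D p (0, 1))"
    and "fst (D p (0, 1)) = - (fst p * fst (\<theta> p) * snd (D p (1, 0)))"
    by simp_all
qed

text \<open>The half-plane result is applied to \<open>\<theta>\<close> and to its conjugate by the
  reflection in the axis. The two resulting formulas share the translation because they agree at the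
  origin, and the scaling factor because both factors equal the x-derivative of u there.\<close>

lemma Aut_b_plus_scale_translate:
  assumes \<theta>: "\<theta> \<in> carrier Aut_b_plus"
  obtains s t where "\<theta> = scale_translate (s, t)"
proof -
  define D where "D = (\<lambda>p. frechet_derivative \<theta> (at p))"
  have mem: "\<theta> \<in> carrier Aut_b" and H: "\<theta> ` right_half_plane = right_half_plane"
    using \<theta> by (auto simp: Aut_b_plus_def)
  then have bij: "bij \<theta>" and sm: "smooth \<theta>" and smi: "smooth (inv_into UNIV \<theta>)"
    by (auto simp: Aut_b_def diffeomorphism_def)
  have diff: "f differentiable (at p)" if "smooth f" for f :: "plane \<Rightarrow> plane" and p
    using that unfolding smooth_def by (metis C_k.simps(2))
  have der: "(\<theta> has_derivative D p) (at p)" for p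
    using diff[OF sm] by (simp add: D_def frechet_derivative_works)
  have CR1: "fst p * fst (D p (1, 0)) = fst (\<theta> p) * snd (D p (0, 1))"
    and CR2: "fst (D p (0, 1)) = - (fst p * fst (\<theta> p) * snd (D p (1, 0)))" for p
    using Aut_b_Cauchy_Riemann[OF mem] by (simp_all add: D_def)
  have lin: "linear (D p)" for p using der by (rule has_derivative_linear)
  \<comment> \<open>Differentiability of the inverse map makes \<open>D p\<close> injective, by the
    chain rule.\<close>
  have nz: "D p (1, 0) \<noteq> 0" for p
  proof
    assume 0: "D p (1, 0) = 0"
    obtain E where E: "(inv_into UNIV \<theta> has_derivative E) (at (\<theta> p))"
      using diff[OF smi, of "\<theta> p"] unfolding differentiable_def by blast
    have "(inv_into UNIV \<theta> \<circ> \<theta> has_derivative E \<circ> D p) (at p)"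
      using diff_chain_at[OF der E] .
    moreover have "inv_into UNIV \<theta> \<circ> \<theta> = id" using bij by (simp add: bij_is_inj)
    ultimately have "E \<circ> D p = id"
      using has_derivative_unique has_derivative_id by metis
    then have "E (D p (1, 0)) = (1, 0)" by (simp add: fun_eq_iff)
    moreover have "E 0 = 0" using has_derivative_linear[OF E] by (rule linear_0)
    ultimately show False using 0 by (simp add: zero_prod_def)
  qed
  have bijH: "bij_betw \<theta> right_half_plane right_half_plane"
    using bij H by (metis bij_betw_subset subset_UNIV)
  obtain c d where c: "c > 0" and right: "\<And>x y. x \<ge> 0 \<Longrightarrow> \<theta> (x, y) = (c * x, y + d)"
    using half_plane_scaling_translation[OF bijH der CR1 CR2 nz] by metis
  \<comment> \<open>The formula on the axis, y \<mapsto> y + d, maps the axis onto itself, and by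
    injectivity no other point lands there. As the right half-plane is preserved too, so is the left
    one.\<close>
  have neg: "fst (\<theta> p) < 0 \<longleftrightarrow> fst p < 0" for p
  proof -
    have "fst (\<theta> p) > 0 \<longleftrightarrow> fst p > 0"
      using H bij inj_image_mem_iff[of \<theta> p right_half_plane] by (simp add: bij_is_inj)
    moreover have "fst (\<theta> p) = 0 \<longleftrightarrow> fst p = 0"
    proof
      assume "fst p = 0"
      then show "fst (\<theta> p) = 0" using right[of 0 "snd p"] by (cases p) simp
    next
      assume "fst (\<theta> p) = 0"
      then have "\<theta> p = \<theta> (0, snd (\<theta> p) - d)" using right[of 0] by (simp add: prod_eq_iff)
      then show "fst p = 0" using bij by (metis bij_is_inj fst_conv injD)
    qed
    ultimately show ?thesis by linarith
  qed
  \<comment> \<open>The reflection fixes \<open>L\<^sub>1\<close> under pushforward, which is why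
    the conjugate \<open>\<theta>'\<close> satisfies the same two differential equations.\<close>
  define R where "R = (\<lambda>p :: plane. (- fst p, snd p))"
  have RR [simp]: "R (R p) = p" for p by (simp add: R_def)
  have dR: "(R has_derivative R) (at p)" for p
    unfolding R_def by (auto intro!: derivative_eq_intros)
  define \<theta>' where "\<theta>' = (\<lambda>p. R (\<theta> (R p)))"
  define D' where "D' = (\<lambda>p h. R (D (R p) (R h)))"
  have der': "(\<theta>' has_derivative D' p) (at p)" for p
    using diff_chain_at[OF diff_chain_at[OF dR der] dR] by (simp add: o_def \<theta>'_def D'_def)
  have D10: "D' p (1, 0) = - R (D (R p) (1, 0))" for p
    using linear_neg[OF lin, of "R p" "(1, 0)"] by (simp add: D'_def R_def)
  have D01: "D' p (0, 1) = R (D (R p) (0, 1))" for p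
    by (simp add: D'_def R_def)
  have bij': "bij_betw \<theta>' right_half_plane right_half_plane"
  proof (rule bij_betw_byWitness[where f' = "\<lambda>p. R (inv_into UNIV \<theta> (R p))"])
    have inv: "inv_into UNIV \<theta> (\<theta> p) = p" "\<theta> (inv_into UNIV \<theta> p) = p" for p
      using bij by (auto simp: bij_is_inj bij_is_surj surj_f_inv_f)
    show "\<forall>p\<in>right_half_plane. R (inv_into UNIV \<theta> (R (\<theta>' p))) = p"
      "\<forall>p\<in>right_half_plane. \<theta>' (R (inv_into UNIV \<theta> (R p))) = p"
      by (simp_all add: \<theta>'_def inv)
    have R_neg: "fst (R p) > 0 \<longleftrightarrow> fst p < 0" "fst (R p) < 0 \<longleftrightarrow> fst p > 0" for p
      by (auto simp: R_def)
    show "\<theta>' ` right_half_plane \<subseteq> right_half_plane"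
      by (auto simp: \<theta>'_def R_neg neg)
    show "(\<lambda>p. R (inv_into UNIV \<theta> (R p))) ` right_half_plane \<subseteq> right_half_plane"
      by (auto simp: R_neg inv simp flip: neg[of "inv_into UNIV \<theta> _"])
  qed
  have CR1': "fst p * fst (D' p (1, 0)) = fst (\<theta>' p) * snd (D' p (0, 1))" for p
    unfolding D10 D01 using CR1[of "R p"] by (simp add: \<theta>'_def R_def)
  have CR2': "fst (D' p (0, 1)) = - (fst p * fst (\<theta>' p) * snd (D' p (1, 0)))" for p
    unfolding D10 D01 using CR2[of "R p"] by (simp add: \<theta>'_def R_def)
  have nz': "D' p (1, 0) \<noteq> 0" for p
    unfolding D10 using nz[of "R p"] by (auto simp: R_def prod_eq_iff)
  obtain c' d' where right': "\<And>x y. x \<ge> 0 \<Longrightarrow> \<theta>' (x, y) = (c' * x, y + d')"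
    using half_plane_scaling_translation[OF bij' der' CR1' CR2' nz'] by metis
  have left: "\<theta> (x, y) = (c' * x, y + d')" if "x \<le> 0" for x y
    using right'[of "- x" y] that by (simp add: \<theta>'_def R_def prod_eq_iff)
  have "d' = d" using left[of 0 0] right[of 0 0] by simp
  \<comment> \<open>Left for an arbitrary \<open>S\<close> because it is used from both sides: the
    quotient is constantly \<open>c\<close> on the right and constantly \<open>c'\<close> on the
    left, with the same limit.\<close>
  have slope_lim: "((\<lambda>x. (fst (\<theta> (x, 0)) - fst (\<theta> (0, 0))) / (x - 0))
      \<longlongrightarrow> fst (D (0, 0) (1, 0))) (at 0 within S)" for S
    using has_field_derivative_at_within[OF has_derivative_slice(1)[OF der]]
    unfolding has_field_derivative_iff .
  have "c = fst (D (0, 0) (1, 0))"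
  proof -
    have "eventually (\<lambda>x. (fst (\<theta> (x, 0)) - fst (\<theta> (0, 0))) / (x - 0) = c) (at_right (0::real))"
      by (simp add: eventually_at_filter right)
    from Lim_transform_eventually[OF slope_lim this]
    have "((\<lambda>x. c) \<longlongrightarrow> fst (D (0, 0) (1, 0))) (at_right (0::real))" .
    then show ?thesis by (simp add: tendsto_const_iff)
  qed
  moreover have "c' = fst (D (0, 0) (1, 0))"
  proof -
    have "eventually (\<lambda>x. (fst (\<theta> (x, 0)) - fst (\<theta> (0, 0))) / (x - 0) = c') (at_left (0::real))"
      by (simp add: eventually_at_filter left)
    from Lim_transform_eventually[OF slope_lim this]
    have "((\<lambda>x. c') \<longlongrightarrow> fst (D (0, 0) (1, 0))) (at_left (0::real))" .
    then show ?thesis by (simp add: tendsto_const_iff)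
  qed
  ultimately have "\<theta> (x, y) = (c * x, y + d)" for x y
    using left[of x y] right[of x y] \<open>d' = d\<close> by (cases "x \<ge> 0") auto
  then have "\<theta> = scale_translate (ln c, d)"
    using c by (auto simp: scale_translate_def fun_eq_iff)
  then show thesis by (rule that)
qed

section \<open>Group structure and generators\<close>

lemma carrier_Aut_b_plus: "carrier Aut_b_plus = range scale_translate"
  using scale_translate_mem by (auto elim: Aut_b_plus_scale_translate)

theorem theorem7p4:
  shows "group Aut_b_plus
    \<and> Aut_b_plus \<cong> real_add_group \<times>\<times> real_add_group
    \<and> vertical_translation \<in> hom real_add_group Aut_b_plus
    \<and> horizontal_scaling \<in> hom real_add_group Aut_b_plus
    \<and> generate Aut_b_plus (range vertical_translation \<union> range horizontal_scaling)
        = carrier Aut_b_plus"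
proof -
  have ops: "mult Aut_b_plus = (\<circ>)" "one Aut_b_plus = id"
    by (simp_all add: Aut_b_plus_def Aut_b_def)
  have R: "group real_add_group"
    by (rule groupI) (auto simp: real_add_group_def intro: exI[of _ "- _"])
  have RR: "group (real_add_group \<times>\<times> real_add_group)"
    using DirProd_group[OF R R] .
  have iso: "scale_translate \<in> iso (real_add_group \<times>\<times> real_add_group) Aut_b_plus"
    using inj_scale_translate
    by (auto simp: iso_def hom_def bij_betw_def carrier_Aut_b_plus ops DirProd_def
        real_add_group_def scale_translate_add)
  \<comment> \<open>Only the monoid laws are checked directly; the existence of inverses is carried
    over from the additive group by the isomorphism.\<close>
  have mon: "monoid Aut_b_plus"
    by (rule monoidI)
       (auto simp: carrier_Aut_b_plus ops scale_translate_add o_assoc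
         simp flip: scale_translate_0)
  have grp: "group Aut_b_plus"
    using group.iso_imp_group[OF RR is_isoI[OF iso] mon] .
  interpret group Aut_b_plus by fact
  have vert: "vertical_translation t = scale_translate (0, t)" for t
    by (auto simp: vertical_translation_def scale_translate_def)
  have horiz: "horizontal_scaling t = scale_translate (t, 0)" for t
    by (auto simp: horizontal_scaling_def scale_translate_def)
  have "vertical_translation \<in> hom real_add_group Aut_b_plus"
    "horizontal_scaling \<in> hom real_add_group Aut_b_plus"
    by (auto simp: hom_def carrier_Aut_b_plus ops real_add_group_def vert horiz scale_translate_add)
  moreover have "generate Aut_b_plus (range vertical_translation \<union> range horizontal_scaling)
      = carrier Aut_b_plus" (is "generate _ ?S = _")
  proof
    show "generate Aut_b_plus ?S \<subseteq> carrier Aut_b_plus"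
      by (rule generate_incl) (auto simp: carrier_Aut_b_plus vert horiz)
    have "scale_translate (s, t) \<in> generate Aut_b_plus ?S" for s t
    proof -
      \<comment> \<open>Each element factors as (s, t) = (s, 0) + (0, t) in parameters, a product of
        one generator of each kind.\<close>
      have "horizontal_scaling s \<otimes>\<^bsub>Aut_b_plus\<^esub> vertical_translation t \<in> generate Aut_b_plus ?S"
        by (intro generate.eng generate.incl) auto
      then show ?thesis by (simp add: ops vert horiz scale_translate_add)
    qed
    then show "carrier Aut_b_plus \<subseteq> generate Aut_b_plus ?S"
      by (auto simp: carrier_Aut_b_plus)
  qed
  moreover have "Aut_b_plus \<cong> real_add_group \<times>\<times> real_add_group"
    using group.iso_sym[OF RR is_isoI[OF iso]] .
  ultimately show ?thesis using grp by blast
qed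

end
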